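(* Let $X$ be a rack and $q$ a $2$-cocycle on $X$. The space of quadratic relations of the Nichols algebra $\mathfrak B(q,X)$ of the braided vector space $W(q,X)$ is $$\mathcal J^2(q,X)=\Bbbk\{\tilde b_C: C\in\mathcal R'(X,q)\},$$ where $\tilde b_C=\sum_{h=1}^{|C|}\eta_h(C)\,w_{i_h}w_{i_{h+1}}$.
   Context: $\Bbbk$ is an algebraically closed field of characteristic zero. A rack is a nonempty set $X$ with $\rhd:X\times X\to X$ such that $x\rhd(y\rhd z)=(x\rhd y)\rhd(x\rhd z)$ and every $y\mapsto x\rhd y$ is bijective. A $2$-cocycle is $q:X\times X\to\Bbbk^\times$ with $q_{x,y\rhd z}q_{y,z}=q_{x\rhd y,x\rhd z}q_{x,z}$. $W(q,X)$ is the vector space with basis $\{w_x\}_{x\in X}$ and braiding $c(w_x\otimes w_y)=q_{y,x}\,w_y\otimes w_{y\rhd x}$. For a braided vector space $W$, $\mathfrak B(W)=T(W)/\mathcal J(W)$ and $\mathcal J^2(W)=\ker(\mathrm{id}+c)\subset W\otimes W$ is the degree-two part of $\mathcal J(W)$; $\mathcal J^2(q,X):=\mathcal J^2(W(q,X))$. Let $\sim$ be the equivalence relation on $X\times X$ generated by $(i,j)\sim(i\rhd j,i)$. For a (finite) class $C$ choose $(i_2,i_1)\in C$ and put $i_{h+2}=i_{h+1}\rhd i_h$, so $C=\{(i_2,i_1),\dots,(i_{|C|},i_{|C|-1}),(i_1,i_{|C|})\}$ (indices modulo $|C|$). $\mathcal R'(X,q)$ is the set of such classes with $\prod_{h=1}^{|C|}q_{i_{h+1},i_h}=(-1)^{|C|}$.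 Further $\eta_1(C)=1$ and $\eta_h(C)=(-1)^{h+1}q_{i_2,i_1}q_{i_3,i_2}\cdots q_{i_h,i_{h-1}}$ for $h\ge2$. *)

theory Defs
  imports "HOL-Library.Poly_Mapping" "HOL-Computational_Algebra.Polynomial"
begin

text \<open>
  The underlying set of a rack is a whole type (nonempty by default); the theorem quantifies over
  this type.
\<close>

definition rack :: "('x \<Rightarrow> 'x \<Rightarrow> 'x) \<Rightarrow> bool" where
  "rack r \<longleftrightarrow> (\<forall>x y z. r x (r y z) = r (r x y) (r x z)) \<and> (\<forall>x. bij (r x))"

definition rack_cocycle :: "('x \<Rightarrow> 'x \<Rightarrow> 'x) \<Rightarrow> ('x \<Rightarrow> 'x \<Rightarrow> 'k::field) \<Rightarrow> bool" where
  "rack_cocycle r q \<longleftrightarrow> (\<forall>x y. q x y \<noteq> 0) \<and>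
     (\<forall>x y z. q x (r y z) * q y z = q (r x y) (r x z) * q x z)"

text \<open>
  The vector space with basis \<open>A\<close> is the type of finitely supported functions on \<open>A\<close>.
  The space \<open>W(q,X)\<close> is \<^typ>\<open>'x \<Rightarrow>\<^sub>0 'k\<close>, and \<open>W(q,X) \<otimes> W(q,X)\<close> is
  \<^typ>\<open>'x \<times> 'x \<Rightarrow>\<^sub>0 'k\<close>, with the bilinear map \<open>tensor\<close> below.
\<close>

definition scale :: "'k::field \<Rightarrow> ('a \<Rightarrow>\<^sub>0 'k) \<Rightarrow> ('a \<Rightarrow>\<^sub>0 'k)" where
  "scale a v = Poly_Mapping.map ((*) a) v"

lemma lookup_scale [simp]: "Poly_Mapping.lookup (scale a v) i = a * Poly_Mapping.lookup v i"
  by (auto simp: scale_def Poly_Mapping.map.rep_eq when_def)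

global_interpretation free_vs: vector_space "scale :: 'k::field \<Rightarrow> ('a \<Rightarrow>\<^sub>0 'k) \<Rightarrow> ('a \<Rightarrow>\<^sub>0 'k)"
  by unfold_locales (auto intro!: poly_mapping_eqI simp: lookup_add algebra_simps)

definition basis_vec :: "'a \<Rightarrow> ('a \<Rightarrow>\<^sub>0 'k::field)" where
  "basis_vec x = Poly_Mapping.single x 1"

definition linear_extension :: "('a \<Rightarrow> ('b \<Rightarrow>\<^sub>0 'k::field)) \<Rightarrow> ('a \<Rightarrow>\<^sub>0 'k) \<Rightarrow> ('b \<Rightarrow>\<^sub>0 'k)" where
  "linear_extension f v = (\<Sum>a\<in>Poly_Mapping.keys v. scale (Poly_Mapping.lookup v a) (f a))"

definition tensor :: "('x \<Rightarrow>\<^sub>0 'k::field) \<Rightarrow> ('x \<Rightarrow>\<^sub>0 'k) \<Rightarrow> ('x \<times> 'x \<Rightarrow>\<^sub>0 'k)" where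
  "tensor u v = linear_extension (\<lambda>x. linear_extension (\<lambda>y. basis_vec (x, y)) v) u"

definition braiding ::
    "('x \<Rightarrow> 'x \<Rightarrow> 'x) \<Rightarrow> ('x \<Rightarrow> 'x \<Rightarrow> 'k::field) \<Rightarrow> ('x \<times> 'x \<Rightarrow>\<^sub>0 'k) \<Rightarrow> ('x \<times> 'x \<Rightarrow>\<^sub>0 'k)" where
  "braiding r q =
     linear_extension (\<lambda>(x, y). scale (q y x) (tensor (basis_vec y) (basis_vec (r y x))))"

lemma linear_extension_alt:
  assumes "finite A" "Poly_Mapping.keys v \<subseteq> A"
  shows "linear_extension f v = (\<Sum>a\<in>A. scale (Poly_Mapping.lookup v a) (f a))"
  unfolding linear_extension_def using assms
  by (intro sum.mono_neutral_left) (auto simp: in_keys_iff)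

lemma linear_extension_basis_vec [simp]: "linear_extension f (basis_vec x) = f x"
  by (simp add: linear_extension_def basis_vec_def)

lemma linear_extension_add:
  "linear_extension f (u + v) = linear_extension f u + linear_extension f v"
proof -
  let ?A = "Poly_Mapping.keys u \<union> Poly_Mapping.keys v"
  have "linear_extension f w = (\<Sum>a\<in>?A. scale (Poly_Mapping.lookup w a) (f a))"
    if "Poly_Mapping.keys w \<subseteq> ?A" for w
    using that by (intro linear_extension_alt) auto
  then show ?thesis
    using Poly_Mapping.keys_add[of u v]
    by (simp add: lookup_add free_vs.scale_left_distrib sum.distrib)
qed

lemma linear_extension_scale:
  "linear_extension f (scale a v) = scale a (linear_extension f v)"
proof -
  have "Poly_Mapping.keys (scale a v) \<subseteq> Poly_Mapping.keys v"
    by (auto simp: in_keys_iff)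
  then have "linear_extension f (scale a v) =
      (\<Sum>i\<in>Poly_Mapping.keys v. scale (Poly_Mapping.lookup (scale a v) i) (f i))"
    by (intro linear_extension_alt) auto
  then show ?thesis
    by (simp add: linear_extension_def free_vs.scale_sum_right)
qed

lemma tensor_basis_vec [simp]: "tensor (basis_vec x) (basis_vec y) = basis_vec (x, y)"
  by (simp add: tensor_def)

lemma braiding_basis_vec:
  "braiding r q (tensor (basis_vec x) (basis_vec y)) =
     scale (q y x) (tensor (basis_vec y) (basis_vec (r y x)))"
  by (simp add: braiding_def)

text \<open>
  \<open>quadratic_relations c\<close> is the kernel of \<open>id + c\<close>, the degree-two part of the defining ideal
  of the Nichols algebra of \<open>(W, c)\<close>.
\<close>

definition quadratic_relations ::
    "(('x \<times> 'x \<Rightarrow>\<^sub>0 'k) \<Rightarrow> ('x \<times> 'x \<Rightarrow>\<^sub>0 'k::field)) \<Rightarrow> ('x \<times> 'x \<Rightarrow>\<^sub>0 'k) set" where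
  "quadratic_relations c = {t. t + c t = 0}"

definition J2 ::
    "('x \<Rightarrow> 'x \<Rightarrow> 'x) \<Rightarrow> ('x \<Rightarrow> 'x \<Rightarrow> 'k::field) \<Rightarrow> ('x \<times> 'x \<Rightarrow>\<^sub>0 'k) set" where
  "J2 r q = quadratic_relations (braiding r q)"

definition pair_rel :: "('x \<Rightarrow> 'x \<Rightarrow> 'x) \<Rightarrow> (('x \<times> 'x) \<times> ('x \<times> 'x)) set" where
  "pair_rel r = {(p, p'). equivclp (\<lambda>(i, j) s. s = (r i j, i)) p p'}"

definition pair_classes :: "('x \<Rightarrow> 'x \<Rightarrow> 'x) \<Rightarrow> ('x \<times> 'x) set set" where
  "pair_classes r = UNIV // pair_rel r"

text \<open>
  \<open>rack_seq r (i\<^sub>2, i\<^sub>1) h\<close> is \<open>i\<^sub>h\<close>; indices start at 1 and the value at 0 is never used.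
  Indices are not reduced modulo \<open>|C|\<close>: if \<open>r\<close> is a rack and the class \<open>C\<close> of
  \<open>(i\<^sub>2, i\<^sub>1)\<close> is finite, the recursion itself is periodic with period \<open>|C|\<close>.
\<close>

fun rack_seq :: "('x \<Rightarrow> 'x \<Rightarrow> 'x) \<Rightarrow> 'x \<times> 'x \<Rightarrow> nat \<Rightarrow> 'x" where
  "rack_seq r p 0 = undefined"
| "rack_seq r p (Suc 0) = snd p"
| "rack_seq r p (Suc (Suc 0)) = fst p"
| "rack_seq r p (Suc (Suc (Suc h))) = r (rack_seq r p (Suc (Suc h))) (rack_seq r p (Suc h))"

text \<open>
  Below, \<open>base\<close> is the choice of a pair \<open>base C = (i\<^sub>2, i\<^sub>1) \<in> C\<close> for every finite class \<open>C\<close>.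
\<close>

definition R' ::
    "('x \<Rightarrow> 'x \<Rightarrow> 'x) \<Rightarrow> ('x \<Rightarrow> 'x \<Rightarrow> 'k::field) \<Rightarrow> (('x \<times> 'x) set \<Rightarrow> 'x \<times> 'x) \<Rightarrow> ('x \<times> 'x) set set"
where
  "R' r q base = {C \<in> pair_classes r. finite C \<and>
     (let i = rack_seq r (base C) in (\<Prod>h=1..card C. q (i (h + 1)) (i h)) = (-1) ^ card C)}"

definition eta ::
    "('x \<Rightarrow> 'x \<Rightarrow> 'x) \<Rightarrow> ('x \<Rightarrow> 'x \<Rightarrow> 'k::field) \<Rightarrow> 'x \<times> 'x \<Rightarrow> nat \<Rightarrow> 'k" where
  "eta r q p h =
     (if h = 1 then 1
      else (-1) ^ (h + 1) * (\<Prod>l=1..h - 1. q (rack_seq r p (l + 1)) (rack_seq r p l)))"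

definition b_tilde ::
    "('x \<Rightarrow> 'x \<Rightarrow> 'x) \<Rightarrow> ('x \<Rightarrow> 'x \<Rightarrow> 'k::field) \<Rightarrow> (('x \<times> 'x) set \<Rightarrow> 'x \<times> 'x) \<Rightarrow> ('x \<times> 'x) set
      \<Rightarrow> ('x \<times> 'x \<Rightarrow>\<^sub>0 'k)" where
  "b_tilde r q base C =
     (let i = rack_seq r (base C) in
       \<Sum>h=1..card C. scale (eta r q (base C) h)
         (tensor (basis_vec (i h)) (basis_vec (i (h + 1)))))"

end

theory Submission
  imports Defs "HOL-Combinatorics.Orbits"
begin

text \<open>
  The braiding permutes the basis vectors \<open>w\<^sub>x w\<^sub>y\<close> up to nonzero scalars, so \<open>t + c t = 0\<close> is a
  first-order recursion for the coefficients of \<open>t\<close>. Let \<open>s (i, j)\<close> be the coefficient of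
  \<open>w\<^sub>j w\<^sub>i\<close> in \<open>t\<close> and let \<open>\<phi> (i, j) = (i \<rhd> j, i)\<close>, the map that generates \<open>\<sim>\<close>. Then \<open>t\<close> is
  a quadratic relation iff \<open>s (\<phi> p) = - q p * s p\<close> for all \<open>p\<close> (\<open>J2_iff\<close>).

  Since \<open>q\<close> does not vanish, the support of \<open>s\<close> is a union of \<open>\<sim>\<close>-classes
  (\<open>multiplier_nonzero_class\<close>), and it is finite, so only finite classes occur in it. As \<open>\<phi>\<close> is
  injective, a finite class \<open>C\<close> is a single \<open>\<phi>\<close>-cycle \<open>p, \<phi> p, \<dots>\<close> of length \<open>|C|\<close>
  (\<open>finite_class_cycle\<close>). Along it the recursion determines \<open>s\<close> from \<open>s p\<close>: the value at
  \<open>\<phi>\<^sup>k p\<close> is \<open>s p\<close> times the product of the first \<open>k\<close> multipliers \<open>- q\<close>, and this product is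
  \<open>\<eta>\<^bsub>k+1\<^esub>(C)\<close>. Closing up after \<open>|C|\<close> steps forces \<open>s p = 0\<close> unless the product of all
  multipliers is \<open>1\<close>, which is the condition \<open>C \<in> \<R>'\<close>. So \<open>t\<close> is the sum of
  \<open>s (base C) \<cdot> b\<^sub>C\<close> over the finitely many classes in its support; conversely each \<open>b\<^sub>C\<close> with
  \<open>C \<in> \<R>'\<close> solves the recursion.
\<close>

section \<open>Finite classes of an injective map\<close>

text \<open>
  The equivalence class of \<open>a\<close> could a priori be larger than the forward orbit, which does not
  contain preimages. If the class is finite, then so is the orbit, hence the injective map \<open>f\<close>
  returns to \<open>a\<close> and permutes the orbit, which is therefore closed under preimages too.
\<close>

lemma finite_class_cycle:
  assumes f: "inj f" and C: "C = Collect (equivclp (\<lambda>x y. y = f x) a)" and fin: "finite C"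
  shows "bij_betw (\<lambda>k. (f ^^ k) a) {..<card C} C" "(f ^^ card C) a = a"
proof -
  let ?R = "\<lambda>x y. y = f x"
  have fwd: "equivclp ?R a ((f ^^ k) a)" for k
    by (induction k) (auto intro: equivclp_into_equivclp)
  have "{y. \<exists>n. y = (f ^^ n) a} \<subseteq> C"
    using fwd C by auto
  then have "finite {y. \<exists>n. y = (f ^^ n) a}"
    using fin finite_subset by blast
  then obtain m where "m > 0" "(f ^^ m) a = a"
    using funpow_inj_finite[OF f] by blast
  then have self: "a \<in> orbit f a"
    unfolding orbit_altdef by force
  have img: "f ` orbit f a = orbit f a"
    using f finite_orbit[OF self]
    by (intro endo_inj_surj) (auto intro: orbit.intros inj_on_subset)
  have "b \<in> orbit f a" if "equivclp ?R a b" for b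
    using that
  proof (induction rule: equivclp_induct)
    case (step y z)
    then show ?case
      using img f by (metis image_iff injD orbit.step)
  qed (use self in auto)
  moreover have "orbit f a \<subseteq> C"
    using fwd C by (auto simp: orbit_altdef)
  ultimately have CO: "C = orbit f a"
    using C by auto
  define d where "d = funpow_dist1 f a a"
  have bij: "bij_betw (\<lambda>k. (f ^^ k) a) {..<d} C"
    unfolding bij_betw_def CO d_def
    using inj_on_funpow_dist1[OF self] orbit_conv_funpow_dist1[OF self]
    by (simp only: lessThan_atLeast0)
  moreover have d: "card C = d"
    using bij_betw_same_card[OF bij] by simp
  ultimately show "bij_betw (\<lambda>k. (f ^^ k) a) {..<card C} C"
    by simp
  show "(f ^^ card C) a = a"
    unfolding d unfolding d_def using funpow_dist1_prop[OF self] by blast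
qed

lemma multiplier_funpow:
  fixes s w :: "'a \<Rightarrow> 'k::comm_monoid_mult"
  assumes "\<And>b. s (f b) = w b * s b"
  shows "s ((f ^^ k) a) = (\<Prod>l<k. w ((f ^^ l) a)) * s a"
  by (induction k) (simp_all add: assms ac_simps)

text \<open>Nonvanishing multipliers propagate nonvanishing both along \<open>f\<close> and against it.\<close>

lemma multiplier_nonzero_class:
  fixes s w :: "'a \<Rightarrow> 'k::semiring_no_zero_divisors"
  assumes "\<And>b. s (f b) = w b * s b" "\<And>b. w b \<noteq> 0"
    and "equivclp (\<lambda>x y. y = f x) a b" "s a \<noteq> 0"
  shows "s b \<noteq> 0"
  using assms(3)
  by (induction rule: equivclp_induct) (use assms in auto)


section \<open>The recursion for the coefficients of a quadratic relation\<close>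

definition twist :: "('x \<Rightarrow> 'x \<Rightarrow> 'x) \<Rightarrow> 'x \<times> 'x \<Rightarrow> 'x \<times> 'x" where
  "twist r = (\<lambda>(i, j). (r i j, i))"

definition multiplier :: "('x \<Rightarrow> 'x \<Rightarrow> 'k::field) \<Rightarrow> 'x \<times> 'x \<Rightarrow> 'k" where
  "multiplier q = (\<lambda>(i, j). - q i j)"

text \<open>
  Classes consist of pairs \<open>(i\<^bsub>h+1\<^esub>, i\<^sub>h)\<close>, whereas \<open>b\<^sub>C\<close> is a combination of the
  \<open>w\<^bsub>i\<^sub>h\<^esub> w\<^bsub>i\<^bsub>h+1\<^esub>\<^esub>\<close>; reading coefficients at swapped pairs reconciles the two orders.
\<close>

definition coeff_swap :: "('x \<times> 'x \<Rightarrow>\<^sub>0 'k::field) \<Rightarrow> 'x \<times> 'x \<Rightarrow> 'k" where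
  "coeff_swap t p = Poly_Mapping.lookup t (prod.swap p)"

lemma coeff_swap_scale [simp]: "coeff_swap (scale a t) p = a * coeff_swap t p"
  and coeff_swap_sum: "coeff_swap (sum g A) p = (\<Sum>x\<in>A. coeff_swap (g x) p)"
  and coeff_swap_basis_vec:
    "coeff_swap (basis_vec (prod.swap p')) p = (if p' = p then 1 else 0)"
  by (auto simp: coeff_swap_def lookup_sum basis_vec_def lookup_single when_def prod_eq_iff)

lemma coeff_swap_eqI: "(\<And>p. coeff_swap t p = coeff_swap u p) \<Longrightarrow> t = u"
  unfolding coeff_swap_def by (metis poly_mapping_eqI swap_swap)

lemma finite_coeff_swap_support: "finite {p. coeff_swap t p \<noteq> 0}"
proof -
  have "finite (prod.swap -` Poly_Mapping.keys t)"
    by (intro finite_vimageI) simp_all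
  then show ?thesis
    by (simp add: vimage_def in_keys_iff coeff_swap_def)
qed

lemma rack_left_cancel: "rack r \<Longrightarrow> r x y = r x y' \<longleftrightarrow> y = y'"
  unfolding rack_def by (metis bij_pointE)

lemma inj_twist: "rack r \<Longrightarrow> inj (twist r)"
  by (auto simp: twist_def rack_left_cancel intro!: injI)

lemma lookup_braiding:
  assumes "rack r"
  shows "Poly_Mapping.lookup (braiding r q t) (i, r i j) = q i j * Poly_Mapping.lookup t (j, i)"
proof -
  have eq: "Poly_Mapping.lookup ((\<lambda>(x, y). scale (q y x) (tensor (basis_vec y)
         (basis_vec (r y x)))) a) (i, r i j) = (if a = (j, i) then q i j else 0)" for a
    using rack_left_cancel[OF assms]
    by (cases a) (auto simp: basis_vec_def[of "(_, _)"] lookup_single when_def)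
  have "Poly_Mapping.lookup (braiding r q t) (i, r i j) =
      (\<Sum>a\<in>Poly_Mapping.keys t. if a = (j, i) then Poly_Mapping.lookup t a * q i j else 0)"
    unfolding braiding_def linear_extension_def lookup_sum lookup_scale eq
    by (rule sum.cong) auto
  then show ?thesis
    by (simp add: in_keys_iff)
qed

text \<open>
  Surjectivity of the translations \<open>r i\<close> enters here: it makes every pair of the form
  \<open>(i, r i j)\<close>, so that the recursion captures all coefficients of \<open>t + c t\<close>.
\<close>

lemma J2_iff:
  assumes "rack r"
  shows "t \<in> J2 r q \<longleftrightarrow> (\<forall>p. coeff_swap t (twist r p) = multiplier q p * coeff_swap t p)"
proof -
  have surj: "\<exists>j. y = r i j" for i y
    using assms by (metis bij_pointE rack_def)
  have "t \<in> J2 r q \<longleftrightarrow> (\<forall>i y. Poly_Mapping.lookup (t + braiding r q t) (i, y) = 0)"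
    by (auto simp: J2_def quadratic_relations_def intro!: poly_mapping_eqI)
  also have "\<dots> \<longleftrightarrow> (\<forall>i j. Poly_Mapping.lookup (t + braiding r q t) (i, r i j) = 0)"
    using surj by metis
  also have "\<dots> \<longleftrightarrow> (\<forall>p. coeff_swap t (twist r p) = multiplier q p * coeff_swap t p)"
    by (simp add: lookup_add lookup_braiding[OF assms] coeff_swap_def twist_def multiplier_def
        add_eq_0_iff2)
  finally show ?thesis .
qed

lemma subspace_J2: "rack r \<Longrightarrow> free_vs.subspace (J2 r q)"
  unfolding free_vs.subspace_def Ball_def J2_iff
  by (simp add: coeff_swap_def lookup_add algebra_simps del: split_paired_All)


section \<open>The classes and the elements \<open>b\<^sub>C\<close> in terms of the recursion\<close>

lemma pair_rel_eq: "pair_rel r = {(p, p'). equivclp (\<lambda>x y. y = twist r x) p p'}"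
proof -
  have "(\<lambda>(i, j) s. s = (r i j, i)) = (\<lambda>x y. y = twist r x)"
    by (auto simp: twist_def fun_eq_iff)
  then show ?thesis
    by (simp add: pair_rel_def)
qed

lemma equiv_pair_rel: "equiv UNIV (pair_rel r)"
  unfolding pair_rel_eq
  by (auto intro!: equivI refl_onI symI transI intro: equivclp_sym equivclp_trans)

lemma pair_class_eq:
  assumes "C \<in> pair_classes r" "p \<in> C"
  shows "C = Collect (equivclp (\<lambda>x y. y = twist r x) p)"
proof -
  have "C = pair_rel r `` {p}"
    using assms equiv_pair_rel unfolding pair_classes_def
    by (metis Image_singleton_iff equiv_class_eq quotientE)
  then show ?thesis
    by (auto simp: pair_rel_eq)
qed

lemma rack_seq_twist:
  "(twist r ^^ k) p = (rack_seq r p (Suc (Suc k)), rack_seq r p (Suc k))"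
  by (induction k) (simp_all add: twist_def)

lemma multiplier_funpow_twist:
  "multiplier q ((twist r ^^ k) p) = - q (rack_seq r p (Suc (Suc k))) (rack_seq r p (Suc k))"
  by (simp add: rack_seq_twist multiplier_def)

lemma prod_multiplier:
  "(\<Prod>l<k. multiplier q ((twist r ^^ l) p)) =
     (-1) ^ k * (\<Prod>h=1..k. q (rack_seq r p (h + 1)) (rack_seq r p h))"
  by (simp add: multiplier_funpow_twist prod_uminus prod.atLeast1_atMost_eq)

lemma eta_eq_prod_multiplier:
  "eta r q p (Suc k) = (\<Prod>l<k. multiplier q ((twist r ^^ l) p))"
  unfolding prod_multiplier by (simp add: eta_def)

lemma R'_iff:
  "C \<in> R' r q base \<longleftrightarrow> C \<in> pair_classes r \<and> finite C \<and>
     (\<Prod>l<card C. multiplier q ((twist r ^^ l) (base C))) = 1"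
proof -
  have "(-1) ^ n * x = 1 \<longleftrightarrow> x = (-1) ^ n" for n and x :: 'b
    by (cases "even n") (auto simp: minus_equation_iff)
  then show ?thesis
    unfolding R'_def prod_multiplier by (auto simp: Let_def)
qed

lemma b_tilde_eq:
  "b_tilde r q base C = (\<Sum>k<card C. scale (\<Prod>l<k. multiplier q ((twist r ^^ l) (base C)))
     (basis_vec (prod.swap ((twist r ^^ k) (base C)))))"
  by (simp add: b_tilde_def Let_def sum.atLeast1_atMost_eq eta_eq_prod_multiplier)
    (simp add: rack_seq_twist)

lemma coeff_swap_b_tilde:
  assumes "bij_betw (\<lambda>k. (twist r ^^ k) (base C)) {..<card C} C"
  shows "k < card C \<Longrightarrow> coeff_swap (b_tilde r q base C) ((twist r ^^ k) (base C)) =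
           (\<Prod>l<k. multiplier q ((twist r ^^ l) (base C)))"
    and "p \<notin> C \<Longrightarrow> coeff_swap (b_tilde r q base C) p = 0"
proof -
  have eq: "coeff_swap (b_tilde r q base C) p =
      (\<Sum>k<card C. if (twist r ^^ k) (base C) = p
         then (\<Prod>l<k. multiplier q ((twist r ^^ l) (base C))) else 0)" for p
    unfolding b_tilde_eq coeff_swap_sum coeff_swap_scale coeff_swap_basis_vec
    by (rule sum.cong) auto
  show "coeff_swap (b_tilde r q base C) ((twist r ^^ k) (base C)) =
           (\<Prod>l<k. multiplier q ((twist r ^^ l) (base C)))" if "k < card C"
  proof -
    have "(twist r ^^ j) (base C) = (twist r ^^ k) (base C) \<longleftrightarrow> j = k" if "j < card C" for j
      using assms that \<open>k < card C\<close> by (auto simp: bij_betw_def inj_on_def)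
    then have "coeff_swap (b_tilde r q base C) ((twist r ^^ k) (base C)) =
        (\<Sum>j<card C. if j = k then (\<Prod>l<j. multiplier q ((twist r ^^ l) (base C))) else 0)"
      unfolding eq by (intro sum.cong) auto
    then show ?thesis
      using that by simp
  qed
  show "coeff_swap (b_tilde r q base C) p = 0" if "p \<notin> C"
    unfolding eq using assms that by (intro sum.neutral) (auto simp: bij_betw_def)
qed


section \<open>The space of quadratic relations\<close>

text \<open>
  The recursion holds from each point of the cycle to the next by definition of \<open>\<eta>\<close>; only the
  step from the last point back to the base is a condition, namely the one defining \<open>\<R>'\<close>.
\<close>

lemma b_tilde_in_J2:
  assumes r: "rack r" and C: "C \<in> R' r q base" and base: "base C \<in> C"
  shows "b_tilde r q base C \<in> J2 r q"
  unfolding J2_iff[OF r]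
proof
  fix p
  let ?n = "card C" and ?s = "coeff_swap (b_tilde r q base C)"
  have cls: "C \<in> pair_classes r" and fin: "finite C"
    and one: "(\<Prod>l<?n. multiplier q ((twist r ^^ l) (base C))) = 1"
    using C by (auto simp: R'_iff)
  note cyc = finite_class_cycle[OF inj_twist[OF r] pair_class_eq[OF cls base] fin]
  note coeff = coeff_swap_b_tilde[of r base C, OF cyc(1)]
  show "?s (twist r p) = multiplier q p * ?s p"
  proof (cases "p \<in> C")
    case True
    then obtain k where k: "k < ?n" "p = (twist r ^^ k) (base C)"
      using cyc(1) by (auto simp: bij_betw_def)
    show ?thesis
    proof (cases "Suc k < ?n")
      case True
      then show ?thesis
        using coeff(1)[of k q] coeff(1)[OF True, of q] k by (simp add: mult.commute)
    next
      case False
      then have n: "?n = Suc k"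
        using k by simp
      have "?s (twist r p) = 1"
        using coeff(1)[of 0 q] cyc(2) k by (simp add: n)
      moreover have "multiplier q p * ?s p = 1"
        using coeff(1)[OF k(1), of q] one k by (simp add: n mult.commute)
      ultimately show ?thesis
        by simp
    qed
  next
    case False
    have "twist r p \<notin> C"
    proof
      assume "twist r p \<in> C"
      then have "C = Collect (equivclp (\<lambda>x y. y = twist r x) (twist r p))"
        using pair_class_eq[OF cls] by blast
      then show False
        using False by (auto intro: equivclp_sym)
    qed
    then show ?thesis
      using False by (simp add: coeff(2))
  qed
qed

text \<open>
  A quadratic relation that is nonzero at one point of a class is nonzero on all of it, so the
  class is finite; comparing the value at its base before and after one turn gives \<open>C \<in> \<R>'\<close>.
\<close>

lemma J2_support_class:
  assumes r: "rack r" and q: "rack_cocycle r q" and t: "t \<in> J2 r q"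
    and C: "C \<in> pair_classes r" and p: "p \<in> C" "coeff_swap t p \<noteq> 0"
    and base: "finite C \<Longrightarrow> base C \<in> C"
  shows "C \<in> R' r q base"
    and "p' \<in> C \<Longrightarrow>
      coeff_swap t p' = coeff_swap t (base C) * coeff_swap (b_tilde r q base C) p'"
proof -
  have rec: "coeff_swap t (twist r b) = multiplier q b * coeff_swap t b" for b
    using t unfolding J2_iff[OF r] by blast
  have nz: "multiplier q b \<noteq> 0" for b
    using q by (cases b) (auto simp: multiplier_def rack_cocycle_def)
  have supp: "coeff_swap t b \<noteq> 0" if "b \<in> C" for b
    using multiplier_nonzero_class[of "coeff_swap t", OF rec nz _ p(2)] that
      pair_class_eq[OF C p(1)] by blast
  then have fin: "finite C"
    using finite_subset[OF _ finite_coeff_swap_support[of t]] by blast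
  note cyc = finite_class_cycle[OF inj_twist[OF r] pair_class_eq[OF C base[OF fin]] fin]
  note pow = multiplier_funpow[of "coeff_swap t", OF rec]
  have "(\<Prod>l<card C. multiplier q ((twist r ^^ l) (base C))) = 1"
    using pow[of "card C" "base C"] supp[OF base[OF fin]] by (simp add: cyc(2))
  then show "C \<in> R' r q base"
    by (simp add: R'_iff C fin)
  show "coeff_swap t p' = coeff_swap t (base C) * coeff_swap (b_tilde r q base C) p'"
    if "p' \<in> C"
  proof -
    have "p' \<in> (\<lambda>k. (twist r ^^ k) (base C)) ` {..<card C}"
      using that bij_betw_imp_surj_on[OF cyc(1)] by simp
    then obtain k where "k < card C" "p' = (twist r ^^ k) (base C)"
      by (elim imageE) simp
    then show ?thesis
      using pow[of k "base C"] coeff_swap_b_tilde(1)[of r base C, OF cyc(1), of k q]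
      by simp
  qed
qed

theorem proposition4p13:
  fixes r :: "'x \<Rightarrow> 'x \<Rightarrow> 'x"
    and q :: "'x \<Rightarrow> 'x \<Rightarrow> 'k::{alg_closed_field, field_char_0}"
    and base :: "('x \<times> 'x) set \<Rightarrow> 'x \<times> 'x"
  assumes "rack r"
    and "rack_cocycle r q"
    and "\<And>C. C \<in> pair_classes r \<Longrightarrow> finite C \<Longrightarrow> base C \<in> C"
  shows "J2 r q = free_vs.span (b_tilde r q base ` R' r q base)"
proof (intro subset_antisym subsetI)
  fix t assume t: "t \<in> J2 r q"
  define S where "S = {C \<in> pair_classes r. \<exists>p\<in>C. coeff_swap t p \<noteq> 0}"
  note supp = J2_support_class[where base = base, OF assms(1,2) t]
  have S: "C \<in> R' r q base" if "C \<in> S" for C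
    using that supp(1) assms(3) by (auto simp: S_def)
  have "S \<subseteq> (\<lambda>p. pair_rel r `` {p}) ` {p. coeff_swap t p \<noteq> 0}"
    using pair_class_eq by (fastforce simp: S_def pair_rel_eq)
  then have fin: "finite S"
    using finite_coeff_swap_support finite_surj by blast
  have "t = (\<Sum>C\<in>S. scale (coeff_swap t (base C)) (b_tilde r q base C))"
  proof (rule coeff_swap_eqI)
    fix p
    define D where "D = pair_rel r `` {p}"
    have D: "D \<in> pair_classes r" "p \<in> D"
      unfolding D_def pair_classes_def
      by (rule quotientI, rule UNIV_I) (rule equiv_class_self[OF equiv_pair_rel UNIV_I])
    (* Classes are disjoint, so only the class D of p contributes at p. *)
    have other: "coeff_swap (b_tilde r q base C) p = 0" if "C \<in> S" "C \<noteq> D" for C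
    proof -
      have C: "C \<in> pair_classes r" "finite C"
        using S[OF that(1)] by (auto simp: R'_iff)
      have "p \<notin> C"
        using pair_class_eq[OF C(1)] pair_class_eq[OF D] that(2) by blast
      then show ?thesis
        using C assms(3) inj_twist[OF assms(1)]
        by (intro coeff_swap_b_tilde(2) finite_class_cycle(1) pair_class_eq) auto
    qed
    have "coeff_swap (\<Sum>C\<in>S. scale (coeff_swap t (base C)) (b_tilde r q base C)) p =
        (\<Sum>C\<in>S. if C = D then coeff_swap t p else 0)"
      unfolding coeff_swap_sum coeff_swap_scale
    proof (rule sum.cong)
      fix C assume C: "C \<in> S"
      show "coeff_swap t (base C) * coeff_swap (b_tilde r q base C) p =
          (if C = D then coeff_swap t p else 0)"
      proof (cases "C = D")
        case True
        then obtain p' where "p' \<in> D" "coeff_swap t p' \<noteq> 0"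
          using C unfolding S_def by blast
        then have "coeff_swap t p = coeff_swap t (base D) * coeff_swap (b_tilde r q base D) p"
          using supp(2)[OF D(1)] assms(3)[OF D(1)] D(2) by blast
        then show ?thesis
          using True by simp
      qed (simp add: other[OF C])
    qed simp
    also have "\<dots> = coeff_swap t p"
      using fin D by (auto simp: S_def)
    finally show "coeff_swap t p =
        coeff_swap (\<Sum>C\<in>S. scale (coeff_swap t (base C)) (b_tilde r q base C)) p" ..
  qed
  moreover have "\<dots> \<in> free_vs.span (b_tilde r q base ` R' r q base)"
    using S by (intro free_vs.span_sum free_vs.span_scale free_vs.span_base) auto
  ultimately show "t \<in> free_vs.span (b_tilde r q base ` R' r q base)"
    by simp
next
  have "b_tilde r q base ` R' r q base \<subseteq> J2 r q"
  proof (rule image_subsetI)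
    fix C assume C: "C \<in> R' r q base"
    then have "base C \<in> C"
      using assms(3) by (simp add: R'_iff)
    then show "b_tilde r q base C \<in> J2 r q"
      using b_tilde_in_J2[OF assms(1) C] by simp
  qed
  then show "t \<in> J2 r q" if "t \<in> free_vs.span (b_tilde r q base ` R' r q base)" for t
    using free_vs.span_minimal[OF _ subspace_J2[OF assms(1)]] that by blast
qed

end
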